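(* Let $\mathbf S=(S,\wedge,0,1)$ be a bounded meet-semilattice (with least element $0$ and greatest element $1$) satisfying the Ascending Chain Condition and let $D$ be a non-empty subset of $S$. Then the following are equivalent: (i) $D$ is a deductive system of $\mathbf S$; (ii) $D$ is a filter of $\mathbf S$; (iii) $\Theta(D)\in\operatorname{Con}\mathbf S$ and $D=[1]\big(\Theta(D)\big)$.
   Context: The Ascending Chain Condition (ACC) means there is no infinite strictly ascending chain. For a subset $A$ of a poset, $\operatorname{Max} A$ denotes the set of all maximal elements of $A$. For $x,y\in S$ define the subset $x\rightarrow y:=\operatorname{Max}\{z\in S\mid x\wedge z\leq y\}$ of $S$. A deductive system of a meet-semilattice $\mathbf S=(S,\wedge,0)$ with $0$ satisfying the ACC is a subset $D$ of $S$ such that (D1) $(\operatorname{Max} S)\cap D\neq\emptyset$, and (D2) for all $x,y\in S$, $x\in D$ and $(x\rightarrow y)\cap D\neq\emptyset$ imply $y\in D$. A filter of a meet-semilattice $(S,\wedge)$ is a non-empty subset $F$ of $S$ such that for all $x,y\in S$: (F1) $x,y\in F$ implies $x\wedge y\in F$; (F2) $x\in F$ and $x\leq y$ imply $y\in F$. For a non-empty subset $A$ of $S$, the binary relation $\Theta(A)$ on $S$ is defined by: $(x,y)\in\Theta(A)$ if there exists some $a\in A$ with $x\wedge a=y\wedge a$. $\operatorname{Con}\mathbf S$ denotes the set of all congruences of $\mathbf S$, i.e. equivalence relations on $S$ compatible with $\wedge$. For a binary relation $\Phi$ on $S$, $[1]\Phi$ denotes the class $\{x\in S\mid (x,1)\in\Phi\}$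 of $1$. *)

theory Defs
  imports Main
begin

text \<open>
  A meet-semilattice is an instance of \<^class>\<open>semilattice_inf\<close>, and its carrier is the whole type.
  A bounded one has the sort \<open>{bounded_semilattice_inf_top, order_bot}\<close>, with \<open>top\<close> and \<open>bot\<close>
  in the roles of \<open>1\<close> and \<open>0\<close>.
\<close>

definition ACC :: "'a::order itself \<Rightarrow> bool" where
  "ACC TYPE('a) \<longleftrightarrow> \<not> (\<exists>c :: nat \<Rightarrow> 'a. strict_mono c)"

text \<open>
  The library's \<^const>\<open>Max\<close> is the greatest element of a finite linearly ordered set. This is the
  set of maximal elements, for an arbitrary partial order.
\<close>

definition Maximals :: "'a::order set \<Rightarrow> 'a set" where
  "Maximals A = {x \<in> A. \<not> (\<exists>y \<in> A. x < y)}"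

definition arrow :: "'a::semilattice_inf \<Rightarrow> 'a \<Rightarrow> 'a set" where
  "arrow x y = Maximals {z. inf x z \<le> y}"

definition deductive_system :: "'a::{semilattice_inf, order_bot} set \<Rightarrow> bool" where
  "deductive_system D \<longleftrightarrow>
     Maximals (UNIV :: 'a set) \<inter> D \<noteq> {} \<and>
     (\<forall>x y. x \<in> D \<and> arrow x y \<inter> D \<noteq> {} \<longrightarrow> y \<in> D)"

definition semilattice_filter :: "'a::semilattice_inf set \<Rightarrow> bool" where
  "semilattice_filter F \<longleftrightarrow>
     F \<noteq> {} \<and>
     (\<forall>x y. x \<in> F \<and> y \<in> F \<longrightarrow> inf x y \<in> F) \<and>
     (\<forall>x y. x \<in> F \<and> x \<le> y \<longrightarrow> y \<in> F)"

definition Theta :: "'a::semilattice_inf set \<Rightarrow> 'a rel" where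
  "Theta A = {(x, y). \<exists>a \<in> A. inf x a = inf y a}"

definition Con :: "'a::semilattice_inf rel set" where
  "Con = {\<Phi>. equiv UNIV \<Phi> \<and>
     (\<forall>x y u v. (x, y) \<in> \<Phi> \<and> (u, v) \<in> \<Phi> \<longrightarrow> (inf x u, inf y v) \<in> \<Phi>)}"

definition class_of_top :: "'a::order_top rel \<Rightarrow> 'a set" where
  "class_of_top \<Phi> = {x. (x, top) \<in> \<Phi>}"

end

theory Submission
  imports Defs
begin

text \<open>
  All three conditions on \<open>D\<close> say that membership in \<open>D\<close> behaves like truth, where \<open>x \<le> y\<close> is
  read as "\<open>x\<close> entails \<open>y\<close>".

  The members of \<open>arrow x y\<close> are the maximal elements that, together with \<open>x\<close>, entail \<open>y\<close>. So
  (D2) is modus ponens. In a filter it holds because any \<open>z \<in> arrow x y\<close> satisfies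
  \<open>inf x z \<le> y\<close>. Conversely, (D1) says \<open>top \<in> D\<close>, and modus ponens then gives upward closure,
  since \<open>x \<le> y\<close> forces \<open>arrow x y = {top}\<close>. It also gives closure under meets: \<open>y\<close> is one of the
  elements that, together with \<open>x\<close>, entail \<open>inf x y\<close>, and the ACC places a maximal one, that is,
  a member of \<open>arrow x (inf x y)\<close>, above \<open>y\<close> (\<open>ACC_maximal_above\<close>). Upward closure puts it
  into \<open>D\<close>.

  For \<open>Theta\<close>, closure of \<open>D\<close> under meets lets two witnesses be replaced by a common one, which is
  what transitivity and compatibility require. The class of \<open>top\<close> under \<open>Theta D\<close> is the upward
  closure of \<open>D\<close>, because \<open>inf x a = inf top a\<close> means \<open>a \<le> x\<close>. For any congruence this class is
  closed under meets, so the third condition gives back a filter.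
\<close>

text \<open>
  Under the ACC the reversed order is well-founded, so the part of \<open>A\<close> above \<open>y\<close> has a maximal
  element. It is maximal in all of \<open>A\<close>, since anything above it is also above \<open>y\<close>.
\<close>

lemma ACC_maximal_above:
  fixes A :: "'a::order set"
  assumes "ACC TYPE('a)" "y \<in> A"
  obtains m where "m \<in> Maximals A" "y \<le> m"
proof -
  have "wf {(b, a :: 'a). a < b}"
    unfolding wf_iff_no_infinite_down_chain
    using assms(1) by (auto simp: ACC_def strict_mono_Suc_iff)
  moreover have "y \<in> {z \<in> A. y \<le> z}"
    using assms(2) by simp
  ultimately obtain m where "m \<in> {z \<in> A. y \<le> z}"
    and "\<And>b. m < b \<Longrightarrow> b \<notin> {z \<in> A. y \<le> z}"
    by (rule wfE_min) blast
  then have "m \<in> Maximals A" "y \<le> m"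
    by (auto simp: Maximals_def dest: order.strict_implies_order intro: order.trans)
  then show thesis by (rule that)
qed

lemma Maximals_UNIV_eq_top: "Maximals (UNIV :: 'a::order_top set) = {top}"
  by (auto simp: Maximals_def) (metis top.not_eq_extremum)

lemma arrow_eq_top:
  fixes x y :: "'a::bounded_semilattice_inf_top"
  assumes "x \<le> y"
  shows "arrow x y = {top}"
proof -
  have "{z. inf x z \<le> y} = UNIV"
    using assms by (auto intro: le_infI1)
  then show ?thesis
    by (simp add: arrow_def Maximals_UNIV_eq_top)
qed

lemma filter_top_mem:
  fixes F :: "'a::bounded_semilattice_inf_top set"
  assumes "semilattice_filter F"
  shows "top \<in> F"
  using assms top_greatest unfolding semilattice_filter_def by blast

lemma deductive_system_imp_filter:
  fixes D :: "'a::{bounded_semilattice_inf_top, order_bot} set"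
  assumes acc: "ACC TYPE('a)" and D: "deductive_system D"
  shows "semilattice_filter D"
proof -
  have top: "top \<in> D"
    and mp: "\<And>x y z. x \<in> D \<Longrightarrow> z \<in> arrow x y \<Longrightarrow> z \<in> D \<Longrightarrow> y \<in> D"
    using D by (auto simp: deductive_system_def Maximals_UNIV_eq_top)
  have up: "y \<in> D" if "x \<in> D" "x \<le> y" for x y
    using mp[OF that(1), of top y] top by (simp add: arrow_eq_top that(2))
  have "inf x y \<in> D" if "x \<in> D" "y \<in> D" for x y
  proof -
    have "y \<in> {z. inf x z \<le> inf x y}"
      by simp
    then obtain m where "m \<in> arrow x (inf x y)" "y \<le> m"
      unfolding arrow_def by (rule ACC_maximal_above[OF acc])
    with that up mp show ?thesis by blast
  qed
  with top up show ?thesis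
    unfolding semilattice_filter_def by blast
qed

lemma filter_imp_deductive_system:
  fixes D :: "'a::{bounded_semilattice_inf_top, order_bot} set"
  assumes D: "semilattice_filter D"
  shows "deductive_system D"
  unfolding deductive_system_def
proof (intro conjI allI impI)
  show "Maximals UNIV \<inter> D \<noteq> {}"
    using filter_top_mem[OF D] by (simp add: Maximals_UNIV_eq_top)
next
  fix x y assume "x \<in> D \<and> arrow x y \<inter> D \<noteq> {}"
  then obtain z where "x \<in> D" "z \<in> D" "inf x z \<le> y"
    by (auto simp: arrow_def Maximals_def)
  with D show "y \<in> D"
    unfolding semilattice_filter_def by blast
qed

lemma Theta_witness_mono:
  assumes "inf x a = inf y a" "b \<le> a"
  shows "inf x b = inf y (b :: 'a::semilattice_inf)"
  using assms by (metis inf.absorb2 inf.assoc)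

text \<open>
  Two pairs in \<open>Theta F\<close> with witnesses \<open>a\<close> and \<open>b\<close> share the witness \<open>inf a b \<in> F\<close>. Transitivity
  and compatibility are then equational facts about a single witness.
\<close>

lemma Theta_filter_in_Con:
  assumes F: "semilattice_filter F"
  shows "Theta F \<in> Con"
proof -
  have common: "\<exists>c\<in>F. inf x c = inf y c \<and> inf u c = inf v c"
    if "(x, y) \<in> Theta F" "(u, v) \<in> Theta F" for x y u v
  proof -
    from that obtain a b where "a \<in> F" "inf x a = inf y a" "b \<in> F" "inf u b = inf v b"
      by (auto simp: Theta_def)
    moreover have "inf a b \<in> F"
      using F \<open>a \<in> F\<close> \<open>b \<in> F\<close> by (auto simp: semilattice_filter_def)
    ultimately show ?thesis
      using Theta_witness_mono inf_le1 inf_le2 by metis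
  qed
  have "refl (Theta F)"
    using F by (auto simp: refl_on_def Theta_def semilattice_filter_def)
  moreover have "sym (Theta F)"
    by (auto simp: sym_def Theta_def) metis
  moreover have "trans (Theta F)"
  proof (rule transI)
    fix x y z assume "(x, y) \<in> Theta F" "(y, z) \<in> Theta F"
    from common[OF this] show "(x, z) \<in> Theta F"
      by (auto simp: Theta_def)
  qed
  moreover have "(inf x u, inf y v) \<in> Theta F"
    if "(x, y) \<in> Theta F" "(u, v) \<in> Theta F" for x y u v
  proof -
    from common[OF that] obtain c where "c \<in> F" "inf x c = inf y c" "inf u c = inf v c"
      by blast
    then have "inf (inf x u) c = inf (inf y v) c"
      by (metis inf.assoc inf.commute)
    with \<open>c \<in> F\<close> show ?thesis
      by (auto simp: Theta_def)
  qed
  ultimately show ?thesis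
    by (auto simp: Con_def equiv_def)
qed

lemma class_of_top_Theta:
  fixes A :: "'a::bounded_semilattice_inf_top set"
  shows "class_of_top (Theta A) = {x. \<exists>a\<in>A. a \<le> x}"
  by (auto simp: class_of_top_def Theta_def le_iff_inf inf.commute)

text \<open>Compatibility yields \<open>inf top top\<close>, which is \<open>top\<close> by idempotence.\<close>

lemma class_of_top_inf_closed:
  fixes \<Phi> :: "'a::bounded_semilattice_inf_top rel"
  assumes "\<Phi> \<in> Con" "x \<in> class_of_top \<Phi>" "y \<in> class_of_top \<Phi>"
  shows "inf x y \<in> class_of_top \<Phi>"
proof -
  have "(inf x y, inf top top) \<in> \<Phi>"
    using assms unfolding Con_def class_of_top_def by blast
  then show ?thesis
    by (simp add: class_of_top_def)
qed

lemma filter_iff_top_class_Theta: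
  fixes D :: "'a::bounded_semilattice_inf_top set"
  assumes "D \<noteq> {}"
  shows "semilattice_filter D \<longleftrightarrow> Theta D \<in> Con \<and> D = class_of_top (Theta D)"
proof (intro iffI conjI)
  assume F: "semilattice_filter D"
  then show "Theta D \<in> Con"
    by (rule Theta_filter_in_Con)
  show "D = class_of_top (Theta D)"
    using F by (auto simp: class_of_top_Theta semilattice_filter_def)
next
  assume "Theta D \<in> Con \<and> D = class_of_top (Theta D)"
  then have con: "Theta D \<in> Con" and D: "D = class_of_top (Theta D)"
    by auto
  have "inf x y \<in> D" if "x \<in> D" "y \<in> D" for x y
    using class_of_top_inf_closed[OF con] that D by blast
  moreover have "y \<in> D" if "x \<in> D" "x \<le> y" for x y
    using that D unfolding class_of_top_Theta by blast
  ultimately show "semilattice_filter D"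
    using assms unfolding semilattice_filter_def by blast
qed

theorem theorem5p3:
  fixes D :: "'a::{bounded_semilattice_inf_top, order_bot} set"
  assumes "ACC TYPE('a)"
    and "D \<noteq> {}"
  shows "(deductive_system D \<longleftrightarrow> semilattice_filter D) \<and>
    (semilattice_filter D \<longleftrightarrow> Theta D \<in> Con \<and> D = class_of_top (Theta D))"
  using deductive_system_imp_filter[OF assms(1)] filter_imp_deductive_system
    filter_iff_top_class_Theta[OF assms(2)]
  by blast

end
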